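(* Let $X$ be a finitely supported subset of an invariant set $Z$. If $X$ contains an infinite finitely supported subset $Y$ together with a total order $\leq$ on $Y$ that is finitely supported (as a subset of $Z\times Z$), then $X$ is FSM uniformly infinite.
   Context: Fix an infinite set $A$ of atoms. $S_A$ is the group of bijections of $A$ that are compositions of finitely many transpositions. An $S_A$-set is a set with a group action $\cdot$ of $S_A$. For $S\subseteq A$, $Fix(S)=\{\pi\in S_A:\pi(a)=a\ \forall a\in S\}$; $S$ supports $x$ if $\pi\cdot x=x$ for all $\pi\in Fix(S)$; the least finite supporting set of $x$ is $supp(x)$. An invariant set is an $S_A$-set all of whose elements have finite supporting sets. Powersets carry $\pi\star U=\{\pi\cdot u:u\in U\}$ and Cartesian products the componentwise action; a finitely supported subset of an invariant set $Z$ is a subset $U$ such that some finite $S\subseteq A$ satisfies $\pi\star U=U$ for all $\pi\in Fix(S)$. A set is uniformly supported if one finite $S\subseteq A$ supports all its elements. A finitely supported subset of an invariant set is FSM uniformly infinite if it contains an infinite uniformly supported subset. *)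

theory Defs
  imports "HOL-Algebra.Group_Action" "HOL-Combinatorics.Permutations"
begin

text \<open>
  The group of atom permutations. A bijection of the set \<open>A\<close> of atoms is represented, as usual in
  \<^theory>\<open>HOL-Combinatorics.Permutations\<close>, by its extension with the identity outside \<open>A\<close>;
  \<^const>\<open>permutation\<close> says that a function is a composition of finitely many transpositions
  (of elements of \<open>A\<close>, by the cycle decomposition, if it is the identity outside \<open>A\<close>).
\<close>

definition atom_perms :: "'a set \<Rightarrow> ('a \<Rightarrow> 'a) monoid" where
  "atom_perms A = \<lparr>carrier = {\<pi>. \<pi> permutes A \<and> permutation \<pi>}, monoid.mult = (\<circ>), one = id\<rparr>"

lemma group_atom_perms: "group (atom_perms A)"
proof (rule groupI)
  fix \<pi> assume "\<pi> \<in> carrier (atom_perms A)"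
  then have "\<pi> permutes A" "permutation \<pi>"
    by (auto simp: atom_perms_def)
  then show "\<exists>\<sigma>\<in>carrier (atom_perms A). \<sigma> \<otimes>\<^bsub>atom_perms A\<^esub> \<pi> = \<one>\<^bsub>atom_perms A\<^esub>"
    by (intro bexI[of _ "inv_into UNIV \<pi>"])
      (auto simp: atom_perms_def Permutations.permutes_inv permutes_inv_o permutation_inverse)
qed (auto simp: atom_perms_def permutes_compose permutation_compose permutes_id comp_assoc)

definition atom_Fix :: "'a set \<Rightarrow> 'a set \<Rightarrow> ('a \<Rightarrow> 'a) set" where
  "atom_Fix A S = {\<pi> \<in> carrier (atom_perms A). \<forall>a\<in>S. \<pi> a = a}"

definition supports :: "'a set \<Rightarrow> (('a \<Rightarrow> 'a) \<Rightarrow> 'x \<Rightarrow> 'x) \<Rightarrow> 'a set \<Rightarrow> 'x \<Rightarrow> bool" where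
  "supports A \<phi> S x \<longleftrightarrow> S \<subseteq> A \<and> (\<forall>\<pi>\<in>atom_Fix A S. \<phi> \<pi> x = x)"

definition invariant_set :: "'a set \<Rightarrow> 'x set \<Rightarrow> (('a \<Rightarrow> 'a) \<Rightarrow> 'x \<Rightarrow> 'x) \<Rightarrow> bool" where
  "invariant_set A Z \<phi> \<longleftrightarrow>
     group_action (atom_perms A) Z \<phi> \<and> (\<forall>z\<in>Z. \<exists>S. finite S \<and> supports A \<phi> S z)"

definition powerset_action :: "(('a \<Rightarrow> 'a) \<Rightarrow> 'x \<Rightarrow> 'x) \<Rightarrow> ('a \<Rightarrow> 'a) \<Rightarrow> 'x set \<Rightarrow> 'x set" where
  "powerset_action \<phi> \<pi> U = {\<phi> \<pi> u |u. u \<in> U}"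

text \<open>
  The restriction to \<open>Z \<times> W\<close> is needed because \<^const>\<open>group_action\<close> is about extensional
  bijections.
\<close>

definition product_action ::
  "'x set \<Rightarrow> (('a \<Rightarrow> 'a) \<Rightarrow> 'x \<Rightarrow> 'x) \<Rightarrow> 'y set \<Rightarrow> (('a \<Rightarrow> 'a) \<Rightarrow> 'y \<Rightarrow> 'y) \<Rightarrow>
     ('a \<Rightarrow> 'a) \<Rightarrow> 'x \<times> 'y \<Rightarrow> 'x \<times> 'y" where
  "product_action Z \<phi> W \<psi> \<pi> = (\<lambda>p\<in>Z \<times> W. (\<phi> \<pi> (fst p), \<psi> \<pi> (snd p)))"

lemma invariant_set_product:
  assumes Z: "invariant_set A Z \<phi>" and W: "invariant_set A W \<psi>"
  shows "invariant_set A (Z \<times> W) (product_action Z \<phi> W \<psi>)"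
proof -
  interpret z: group_action "atom_perms A" Z \<phi> using Z by (simp add: invariant_set_def)
  interpret w: group_action "atom_perms A" W \<psi> using W by (simp add: invariant_set_def)
  let ?G = "atom_perms A" let ?P = "product_action Z \<phi> W \<psi>"
  have el: "\<phi> g x \<in> Z" "\<psi> g y \<in> W" if "g \<in> carrier ?G" "x \<in> Z" "y \<in> W" for g x y
    using that z.element_image w.element_image by blast+
  have bij: "?P g \<in> Bij (Z \<times> W)" if g: "g \<in> carrier ?G" for g
  proof -
    have "bij_betw (\<phi> g) Z Z" "bij_betw (\<psi> g) W W"
      using z.bij_prop0 w.bij_prop0 g by (auto simp: Bij_def)
    then have "bij_betw (map_prod (\<phi> g) (\<psi> g)) (Z \<times> W) (Z \<times> W)"
      by (rule bij_betw_map_prod)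
    then have "bij_betw (?P g) (Z \<times> W) (Z \<times> W)"
      by (rule bij_betw_cong[THEN iffD1, rotated]) (auto simp: product_action_def)
    then show ?thesis by (simp add: Bij_def product_action_def)
  qed
  have "group_action ?G (Z \<times> W) ?P"
    unfolding group_action_def
  proof (intro group_hom.intro group_hom_axioms.intro homI group_atom_perms group_BijGroup)
    fix g assume "g \<in> carrier ?G" then show "?P g \<in> carrier (BijGroup (Z \<times> W))"
      by (simp add: BijGroup_def bij)
  next
    fix g h assume g: "g \<in> carrier ?G" and h: "h \<in> carrier ?G"
    have "?P (g \<otimes>\<^bsub>?G\<^esub> h) = compose (Z \<times> W) (?P g) (?P h)"
      using g h by (auto simp: product_action_def compose_def fun_eq_iff el
        z.composition_rule w.composition_rule)
    then show "?P (g \<otimes>\<^bsub>?G\<^esub> h) = ?P g \<otimes>\<^bsub>BijGroup (Z \<times> W)\<^esub> ?P h"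
      using g h by (simp add: BijGroup_def bij)
  qed
  moreover have "\<exists>U. finite U \<and> supports A ?P U p" if "p \<in> Z \<times> W" for p
  proof -
    have "fst p \<in> Z" "snd p \<in> W"
      using that by auto
    then obtain S T where "finite S" "supports A \<phi> S (fst p)" "finite T" "supports A \<psi> T (snd p)"
      using Z W unfolding invariant_set_def by blast
    then show ?thesis using that
      by (intro exI[of _ "S \<union> T"]) (auto simp: supports_def atom_Fix_def product_action_def)
  qed
  ultimately show ?thesis by (simp add: invariant_set_def)
qed

definition finitely_supported_subset ::
  "'a set \<Rightarrow> 'x set \<Rightarrow> (('a \<Rightarrow> 'a) \<Rightarrow> 'x \<Rightarrow> 'x) \<Rightarrow> 'x set \<Rightarrow> bool" where
  "finitely_supported_subset A Z \<phi> U \<longleftrightarrow>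
     U \<subseteq> Z \<and> (\<exists>S. finite S \<and> supports A (powerset_action \<phi>) S U)"

definition uniformly_supported :: "'a set \<Rightarrow> (('a \<Rightarrow> 'a) \<Rightarrow> 'x \<Rightarrow> 'x) \<Rightarrow> 'x set \<Rightarrow> bool" where
  "uniformly_supported A \<phi> U \<longleftrightarrow> (\<exists>S. finite S \<and> S \<subseteq> A \<and> (\<forall>u\<in>U. supports A \<phi> S u))"

definition FSM_uniformly_infinite ::
  "'a set \<Rightarrow> 'x set \<Rightarrow> (('a \<Rightarrow> 'a) \<Rightarrow> 'x \<Rightarrow> 'x) \<Rightarrow> 'x set \<Rightarrow> bool" where
  "FSM_uniformly_infinite A Z \<phi> X \<longleftrightarrow>
     finitely_supported_subset A Z \<phi> X \<and>
     (\<exists>U\<subseteq>X. infinite U \<and> uniformly_supported A \<phi> U)"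

end

theory Submission
  imports Defs "HOL-Combinatorics.Cycles"
begin

text \<open>
  An atom permutation has finite order, so it moves every element of \<open>Z\<close> along a finite cycle. If it
  preserves a linear order and moves \<open>y\<close> to a comparable element, then the iterates of \<open>y\<close> form a
  monotone chain that returns to \<open>y\<close>, hence \<open>y\<close> is fixed. So any finite set that supports \<open>Y\<close> and
  \<open>le\<close> supports every element of \<open>Y\<close>, and \<open>Y\<close> itself is uniformly supported.
\<close>

text \<open>Stated for a bare relation so that it applies to an order and to its converse
  alike.\<close>

lemma monotone_cycle_fixed:
  assumes "trans r" and "antisym r"
    and mono: "\<And>x y. (x, y) \<in> r \<Longrightarrow> (f x, f y) \<in> r"
    and "(x, f x) \<in> r" and "n > 0" and "(f ^^ n) x = x"
  shows "f x = x"
proof -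
  have step: "((f ^^ k) x, (f ^^ Suc k) x) \<in> r" for k
    by (induction k) (use assms(4) mono in auto)
  \<comment> \<open>The equality covers \<open>k = 0\<close>, where the second disjunct would
    require reflexivity of \<open>r\<close>.\<close>
  have "f x = (f ^^ Suc k) x \<or> (f x, (f ^^ Suc k) x) \<in> r" for k
  proof (induction k)
    case (Suc k)
    then show ?case using step[of "Suc k"] \<open>trans r\<close> by (auto dest: transD)
  qed simp
  \<comment> \<open>As \<open>n > 0\<close>, the iterate at \<open>Suc (n - 1)\<close> is
    \<open>x\<close> itself, so the chain gives \<open>f x = x\<close> or
    \<open>(f x, x) \<in> r\<close>; the latter meets \<open>(x, f x) \<in> r\<close> in
    antisymmetry.\<close>
  from this[of "n - 1"] show ?thesis
    using assms(2,4-6) by (auto dest: antisymD)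
qed

text \<open>An action is a homomorphism, so it sends powers to powers; this carries the finite order
  of \<open>\<pi>\<close> over to the orbit of \<open>z\<close>.\<close>

lemma group_action_funpow:
  assumes "group_action (atom_perms A) Z \<phi>" and "\<pi> \<in> carrier (atom_perms A)" and "z \<in> Z"
  shows "\<phi> (\<pi> ^^ n) z = (\<phi> \<pi> ^^ n) z"
proof -
  interpret group_action "atom_perms A" Z \<phi> by fact
  have one: "\<one>\<^bsub>atom_perms A\<^esub> = id" and mult: "x \<otimes>\<^bsub>atom_perms A\<^esub> y = x \<circ> y" for x y
    by (simp_all add: atom_perms_def)
  have "\<pi> ^^ n \<in> carrier (atom_perms A)" for n
    using assms(2) group.is_monoid[OF group_atom_perms, of A]
    by (induction n) (auto simp flip: one mult intro: monoid.m_closed monoid.one_closed)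
  \<comment> \<open>The unit acts as the identity restricted to \<open>Z\<close>, hence the appeal
    to \<open>z \<in> Z\<close>.\<close>
  moreover have "\<phi> id z = z"
    using assms(3) id_eq_one by (metis one restrict_apply')
  ultimately show ?thesis
    using assms(2,3) composition_rule[of z \<pi>] by (induction n) (auto simp: mult)
qed

text \<open>Invariance of \<open>Y\<close> keeps the image of \<open>y\<close> comparable with
  \<open>y\<close>; invariance of \<open>le\<close> makes the action of \<open>\<pi>\<close>
  monotone.\<close>

lemma supports_element_of_linear_order:
  fixes le :: "('x \<times> 'x) set"
  assumes act: "group_action (atom_perms A) Z \<phi>"
    and Y: "supports A (powerset_action \<phi>) S Y" "Y \<subseteq> Z"
    and le: "supports A (powerset_action (product_action Z \<phi> Z \<phi>)) S le" "le \<subseteq> Z \<times> Z"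
    and lin: "linear_order_on Y le" and "y \<in> Y"
  shows "supports A \<phi> S y"
  unfolding supports_def
proof (intro conjI ballI)
  show "S \<subseteq> A" using Y(1) by (simp add: supports_def)
  fix \<pi> assume \<pi>: "\<pi> \<in> atom_Fix A S"
  have mono: "(\<phi> \<pi> u, \<phi> \<pi> v) \<in> le" if "(u, v) \<in> le" for u v
  proof -
    have "product_action Z \<phi> Z \<phi> \<pi> (u, v) \<in> powerset_action (product_action Z \<phi> Z \<phi>) \<pi> le"
      using that by (auto simp: powerset_action_def)
    moreover have "(u, v) \<in> Z \<times> Z" using that le(2) by blast
    ultimately show ?thesis
      using le(1) \<pi> by (simp add: supports_def product_action_def)
  qed
  have "\<phi> \<pi> y \<in> powerset_action \<phi> \<pi> Y"
    using \<open>y \<in> Y\<close> by (auto simp: powerset_action_def)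
  then have "\<phi> \<pi> y \<in> Y" using Y(1) \<pi> by (simp add: supports_def)
  have carr: "\<pi> \<in> carrier (atom_perms A)" using \<pi> by (simp add: atom_Fix_def)
  then have "permutation \<pi>" by (simp add: atom_perms_def)
  then obtain n where n: "\<pi> ^^ n = id" "n > 0"
    using permutation_is_nilpotent by metis
  have "y \<in> Z" using \<open>y \<in> Y\<close> Y(2) by blast
  \<comment> \<open>The instance at exponent 0 supplies \<open>\<phi> id y = y\<close>.\<close>
  then have cycle: "(\<phi> \<pi> ^^ n) y = y"
    using group_action_funpow[OF act carr, of y n] group_action_funpow[OF act carr, of y 0] n(1)
    by simp
  have ord: "trans le" "antisym le" "total_on Y le"
    using lin by (auto simp: linear_order_on_def partial_order_on_def preorder_on_def)
  \<comment> \<open>Totality compares distinct elements only, hence the contradiction. If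
    \<open>y\<close> lies above its image, the chain is followed in the converse of
    \<open>le\<close>.\<close>
  show "\<phi> \<pi> y = y"
  proof (rule ccontr)
    assume ne: "\<phi> \<pi> y \<noteq> y"
    with ord(3) \<open>y \<in> Y\<close> \<open>\<phi> \<pi> y \<in> Y\<close> have "(y, \<phi> \<pi> y) \<in> le \<or> (y, \<phi> \<pi> y) \<in> le\<inverse>"
      by (auto simp: total_on_def)
    then show False
      using monotone_cycle_fixed[of le "\<phi> \<pi>" y n] monotone_cycle_fixed[of "le\<inverse>" "\<phi> \<pi>" y n]
        ord(1,2) mono cycle n(2) ne by auto
  qed
qed

theorem theorem3p11:
  fixes A :: "'a set"
    and Z :: "'x set"
    and \<phi> :: "('a \<Rightarrow> 'a) \<Rightarrow> 'x \<Rightarrow> 'x"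
    and X Y :: "'x set"
    and le :: "('x \<times> 'x) set"
  assumes "infinite A"
    and "invariant_set A Z \<phi>"
    and "finitely_supported_subset A Z \<phi> X"
    and "Y \<subseteq> X"
    and "infinite Y"
    and "finitely_supported_subset A Z \<phi> Y"
    and "linear_order_on Y le"
    and "finitely_supported_subset A (Z \<times> Z) (product_action Z \<phi> Z \<phi>) le"
  shows "FSM_uniformly_infinite A Z \<phi> X"
proof -
  obtain S where S: "finite S" "supports A (powerset_action \<phi>) S Y" and "Y \<subseteq> Z"
    using assms(6) by (auto simp: finitely_supported_subset_def)
  obtain T where T: "finite T" "supports A (powerset_action (product_action Z \<phi> Z \<phi>)) T le"
    and "le \<subseteq> Z \<times> Z"
    using assms(8) by (auto simp: finitely_supported_subset_def)
  \<comment> \<open>Enlarging a supporting set within \<open>A\<close> shrinks its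
    \<open>atom_Fix\<close>, so the union supports both.\<close>
  have "supports A (powerset_action \<phi>) (S \<union> T) Y"
    and "supports A (powerset_action (product_action Z \<phi> Z \<phi>)) (S \<union> T) le"
    using S(2) T(2) by (auto simp: supports_def atom_Fix_def)
  then have "supports A \<phi> (S \<union> T) y" if "y \<in> Y" for y
    using supports_element_of_linear_order[of A Z \<phi> "S \<union> T" Y le y] assms(2,7) that
      \<open>Y \<subseteq> Z\<close> \<open>le \<subseteq> Z \<times> Z\<close> by (simp add: invariant_set_def)
  moreover have "S \<union> T \<subseteq> A"
    using S(2) T(2) by (simp add: supports_def)
  ultimately have "uniformly_supported A \<phi> Y"
    using S(1) T(1) unfolding uniformly_supported_def by (intro exI[of _ "S \<union> T"]) simp
  then show ?thesis
    using assms(3-5) by (auto simp: FSM_uniformly_infinite_def)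
qed

end
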